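(* Let $u=(u_k)_{k\ge 0}$ and $v=(v_k)_{k\ge 0}$ be sequences of scalars in $U$ (all terms nonzero). For each $\lambda\in\{\ell_\infty,c,c_0\}$, the sequence space $\lambda(u,v,\Delta)$ is a complete normed linear space with respect to the norm defined by $$\|x\|_{\lambda(u,v,\Delta)}=\sup_{k}\left|\sum_{i=0}^{k}u_k v_i\,\Delta x_i\right|=\|y\|_{\lambda},$$ where $y=(y_k)_{k\ge0}$ is the sequence $y_k=\sum_{i=0}^{k}u_kv_i\,\Delta x_i$ and $\|\cdot\|_\lambda$ is the supremum norm.
   Context: Let $N=\{0,1,2,\dots\}$. $w$ denotes the linear space of all real or complex valued sequences $x=(x_k)_{k\in N}$ (with coordinatewise operations), and $\ell_\infty$, $c$, $c_0\subset w$ denote the spaces of bounded, convergent and null sequences, respectively, each with the supremum norm. $U$ is the set of all sequences $u=(u_k)_{k\in N}$ with $u_k\neq 0$ for all $k\in N$. For $x\in w$, $\Delta x=(\Delta x_k)_{k\in N}$ is defined by $\Delta x_k=x_k-x_{k-1}$, with the convention $x_{-1}=0$. For $\lambda\in\{\ell_\infty,c,c_0\}$ and $u,v\in U$, $$\lambda(u,v,\Delta)=\left\{x=(x_k)\in w:\ \left(\sum_{i=0}^{k}u_kv_i\,\Delta x_i\right)_{k\in N}\in\lambda\right\}.$$ *)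

theory Defs
  imports "HOL-Analysis.Analysis" "HOL-Library.Function_Algebras"
begin

text \<open>
  The scalars range over a type of class \<open>{real_normed_field, banach}\<close>, which covers both
  \<^typ>\<open>real\<close> and \<^typ>\<open>complex\<close>. The space of all scalar sequences is the full function type;
  its pointwise additive structure comes from \<open>HOL-Library.Function_Algebras\<close>.
\<close>

definition seq_scale :: "'a::field \<Rightarrow> (nat \<Rightarrow> 'a) \<Rightarrow> (nat \<Rightarrow> 'a)" where
  "seq_scale c x = (\<lambda>k. c * x k)"

definition bounded_seqs :: "(nat \<Rightarrow> 'a::real_normed_field) set" where
  "bounded_seqs = {x. bounded (range x)}"

definition convergent_seqs :: "(nat \<Rightarrow> 'a::real_normed_field) set" where
  "convergent_seqs = {x. convergent x}"

definition null_seqs :: "(nat \<Rightarrow> 'a::real_normed_field) set" where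
  "null_seqs = {x. x \<longlonglongrightarrow> 0}"

text \<open>The supremum is the intended one only for bounded sequences; all uses below are of this kind.\<close>

definition sup_norm :: "(nat \<Rightarrow> 'a::real_normed_field) \<Rightarrow> real" where
  "sup_norm x = (SUP k. norm (x k))"

definition nonzero_seqs :: "(nat \<Rightarrow> 'a::field) set" where
  "nonzero_seqs = {u. \<forall>k. u k \<noteq> 0}"

definition bdiff :: "(nat \<Rightarrow> 'a::ab_group_add) \<Rightarrow> (nat \<Rightarrow> 'a)" where
  "bdiff x = (\<lambda>k. x k - (if k = 0 then 0 else x (k - 1)))"

definition diff_transform ::
    "(nat \<Rightarrow> 'a::field) \<Rightarrow> (nat \<Rightarrow> 'a) \<Rightarrow> (nat \<Rightarrow> 'a) \<Rightarrow> (nat \<Rightarrow> 'a)" where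
  "diff_transform u v x = (\<lambda>k. \<Sum>i\<le>k. u k * v i * bdiff x i)"

definition diff_space ::
    "(nat \<Rightarrow> 'a::field) set \<Rightarrow> (nat \<Rightarrow> 'a) \<Rightarrow> (nat \<Rightarrow> 'a) \<Rightarrow> (nat \<Rightarrow> 'a) set" where
  "diff_space L u v = {x. diff_transform u v x \<in> L}"

definition diff_norm ::
    "(nat \<Rightarrow> 'a::real_normed_field) \<Rightarrow> (nat \<Rightarrow> 'a) \<Rightarrow> (nat \<Rightarrow> 'a) \<Rightarrow> real" where
  "diff_norm u v x = (SUP k. norm (\<Sum>i\<le>k. u k * v i * bdiff x i))"

text \<open>
  Normed linear spaces are carried by a set \<open>V\<close> with an explicit norm \<open>N\<close>, since one function type
  carries many of them. Completeness is written out rather than taken from the locale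
  \<open>Metric_space\<close>, which constrains the distance also outside the carrier, where the supremum
  defining \<open>N\<close> need not exist.
\<close>

definition normed_linear_space_on ::
    "('k::real_normed_field \<Rightarrow> 'v::ab_group_add \<Rightarrow> 'v) \<Rightarrow> 'v set \<Rightarrow> ('v \<Rightarrow> real) \<Rightarrow> bool" where
  "normed_linear_space_on smul V N \<longleftrightarrow>
     vector_space smul \<and> module.subspace smul V \<and>
     (\<forall>x\<in>V. 0 \<le> N x) \<and>
     (\<forall>x\<in>V. N x = 0 \<longleftrightarrow> x = 0) \<and>
     (\<forall>c. \<forall>x\<in>V. N (smul c x) = norm c * N x) \<and>
     (\<forall>x\<in>V. \<forall>y\<in>V. N (x + y) \<le> N x + N y)"

definition norm_complete_on :: "'v::ab_group_add set \<Rightarrow> ('v \<Rightarrow> real) \<Rightarrow> bool" where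
  "norm_complete_on V N \<longleftrightarrow>
     (\<forall>\<sigma>::nat \<Rightarrow> 'v. range \<sigma> \<subseteq> V \<longrightarrow>
        (\<forall>\<epsilon>>0. \<exists>M. \<forall>m\<ge>M. \<forall>n\<ge>M. N (\<sigma> m - \<sigma> n) < \<epsilon>) \<longrightarrow>
        (\<exists>x\<in>V. (\<lambda>n. N (\<sigma> n - x)) \<longlonglongrightarrow> 0))"

end

theory Submission imports Defs begin

text \<open>
  The transform \<open>T = diff_transform u v\<close> is a linear bijection of the space of all scalar sequences
  onto itself. Backward difference and partial summation are mutually inverse, so
  \<open>T x k = u k * (\<Sum>i\<le>k. v i * bdiff x i)\<close> can be undone in four steps: divide by \<open>u\<close>, take
  differences, divide by \<open>v\<close>, and sum (\<open>bij_diff_transform\<close>). By definition the space attached to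
  \<open>L\<close> is the preimage of \<open>L\<close> under \<open>T\<close>, and its norm is the supremum norm composed with \<open>T\<close>. Hence
  \<open>T\<close> restricts to an isometric isomorphism onto \<open>L\<close>, and both the norm axioms and completeness
  transfer from \<open>L\<close> (\<open>normed_linear_space_on_vimage\<close>, \<open>norm_complete_on_vimage\<close>).

  What remains is classical: the bounded, the convergent and the null sequences are Banach spaces
  under the supremum norm. All three are subspaces of the bounded sequences that are closed under
  uniform limits, and a sequence of sequences that is Cauchy for the supremum norm has a uniform
  limit because the scalars are complete (\<open>norm_complete_on_sup_norm\<close>).
\<close>

section \<open>Transport of norms along linear maps\<close>

text \<open>
  Injectivity is what makes the pulled-back seminorm definite.
\<close>

lemma normed_linear_space_on_vimage:
  assumes T: "Vector_Spaces.linear smul1 smul2 T" and "inj T"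
    and V: "normed_linear_space_on smul2 V N"
  shows "normed_linear_space_on smul1 (T -` V) (\<lambda>x. N (T x))"
proof -
  interpret T: Vector_Spaces.linear smul1 smul2 T by (rule T)
  have "T x = 0 \<longleftrightarrow> x = 0" for x
    using \<open>inj T\<close> T.zero by (metis injD)
  then show ?thesis
    using V T.vs1.vector_space_axioms T.subspace_vimage
    unfolding normed_linear_space_on_def by (simp add: T.add T.scale)
qed

text \<open>
  Surjectivity supplies the limit: the images of a Cauchy sequence converge in \<open>V\<close>, and any preimage
  of their limit is a limit of the original sequence.
\<close>

lemma norm_complete_on_vimage:
  assumes T: "Vector_Spaces.linear smul1 smul2 T" and "surj T" and V: "norm_complete_on V N"
  shows "norm_complete_on (T -` V) (\<lambda>x. N (T x))"
  unfolding norm_complete_on_def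
proof (intro allI impI)
  fix \<sigma> :: "nat \<Rightarrow> _"
  interpret T: Vector_Spaces.linear smul1 smul2 T by (rule T)
  assume "range \<sigma> \<subseteq> T -` V"
    and "\<forall>\<epsilon>>0. \<exists>M. \<forall>m\<ge>M. \<forall>n\<ge>M. N (T (\<sigma> m - \<sigma> n)) < \<epsilon>"
  then have "range (\<lambda>n. T (\<sigma> n)) \<subseteq> V"
    and "\<forall>\<epsilon>>0. \<exists>M. \<forall>m\<ge>M. \<forall>n\<ge>M. N (T (\<sigma> m) - T (\<sigma> n)) < \<epsilon>"
    by (auto simp: T.diff)
  then have "\<exists>y\<in>V. (\<lambda>n. N (T (\<sigma> n) - y)) \<longlonglongrightarrow> 0"
    by (rule V[unfolded norm_complete_on_def, THEN spec, THEN mp, THEN mp])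
  then obtain y where "y \<in> V" "(\<lambda>n. N (T (\<sigma> n) - y)) \<longlonglongrightarrow> 0" ..
  moreover obtain x where "y = T x"
    using \<open>surj T\<close> by blast
  ultimately show "\<exists>x\<in>T -` V. (\<lambda>n. N (T (\<sigma> n - x))) \<longlonglongrightarrow> 0"
    by (auto simp: T.diff)
qed

section \<open>The supremum norm on bounded sequences\<close>

lemma vector_space_seq_scale: "vector_space (seq_scale :: 'a::field \<Rightarrow> _)"
  by unfold_locales (auto simp: seq_scale_def fun_eq_iff algebra_simps)

lemma norm_le_sup_norm:
  assumes "x \<in> bounded_seqs"
  shows "norm (x k) \<le> sup_norm x"
proof -
  have "bdd_above (range (\<lambda>k. norm (x k)))"
    using assms by (auto simp: bounded_seqs_def bounded_iff bdd_above_def)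
  then show ?thesis
    unfolding sup_norm_def by (rule cSUP_upper[OF UNIV_I])
qed

lemma sup_norm_le:
  assumes "\<And>k. norm (x k) \<le> B"
  shows "sup_norm x \<le> B"
  unfolding sup_norm_def using assms by (intro cSUP_least) auto

lemma sup_norm_nonneg: "x \<in> bounded_seqs \<Longrightarrow> 0 \<le> sup_norm x"
  by (rule order_trans[OF norm_ge_zero norm_le_sup_norm])

lemma sup_norm_seq_scale_le:
  assumes "x \<in> bounded_seqs"
  shows "sup_norm (seq_scale c x) \<le> norm c * sup_norm x"
  using norm_le_sup_norm[OF assms]
  by (auto intro!: sup_norm_le mult_left_mono simp: seq_scale_def norm_mult)

lemma subspace_bounded_seqs:
  "module.subspace seq_scale (bounded_seqs :: (nat \<Rightarrow> 'a::real_normed_field) set)"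
proof -
  interpret vector_space "seq_scale :: 'a \<Rightarrow> _" by (rule vector_space_seq_scale)
  show ?thesis
  proof (rule subspaceI)
    fix x y :: "nat \<Rightarrow> 'a"
    assume xy: "x \<in> bounded_seqs" "y \<in> bounded_seqs"
    have "norm ((x + y) k) \<le> sup_norm x + sup_norm y" for k
      using norm_triangle_mono[OF xy[THEN norm_le_sup_norm]] by simp
    then show "x + y \<in> bounded_seqs"
      unfolding bounded_seqs_def by (auto intro!: boundedI)
  next
    fix c and x :: "nat \<Rightarrow> 'a"
    assume x: "x \<in> bounded_seqs"
    have "norm (seq_scale c x k) \<le> norm c * sup_norm x" for k
      using norm_le_sup_norm[OF x] by (auto intro!: mult_left_mono simp: seq_scale_def norm_mult)
    then show "seq_scale c x \<in> bounded_seqs"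
      unfolding bounded_seqs_def by (auto intro!: boundedI)
  qed (auto simp: bounded_seqs_def zero_fun_def)
qed

lemma normed_linear_space_on_bounded_seqs:
  "normed_linear_space_on seq_scale (bounded_seqs :: (nat \<Rightarrow> 'a::real_normed_field) set) sup_norm"
proof -
  interpret vector_space "seq_scale :: 'a \<Rightarrow> _" by (rule vector_space_seq_scale)
  have sup_norm_0: "sup_norm (0 :: nat \<Rightarrow> 'a) = 0"
    by (simp add: sup_norm_def)
  have definite: "x = 0" if "x \<in> bounded_seqs" "sup_norm x = 0" for x :: "nat \<Rightarrow> 'a"
    using norm_le_sup_norm[OF that(1)] that(2) by (auto simp: fun_eq_iff)
  have triangle: "sup_norm (x + y) \<le> sup_norm x + sup_norm y"
    if "x \<in> bounded_seqs" "y \<in> bounded_seqs" for x y :: "nat \<Rightarrow> 'a"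
    using norm_triangle_mono[OF that[THEN norm_le_sup_norm]] by (intro sup_norm_le) simp
  have homogeneous: "sup_norm (seq_scale c x) = norm c * sup_norm x"
    if x: "x \<in> bounded_seqs" for c and x :: "nat \<Rightarrow> 'a"
  proof (cases "c = 0")
    case True
    then show ?thesis by (simp add: sup_norm_0)
  next
    case False
    \<comment> \<open>The reverse inequality is the easy one applied to \<open>x = c\<inverse> (c x)\<close>.\<close>
    have "sup_norm (seq_scale (inverse c) (seq_scale c x))
        \<le> norm (inverse c) * sup_norm (seq_scale c x)"
      by (intro sup_norm_seq_scale_le subspace_scale subspace_bounded_seqs x)
    then have "sup_norm x \<le> sup_norm (seq_scale c x) / norm c"
      using False by (simp add: nonzero_norm_inverse divide_inverse mult.commute)
    then have "norm c * sup_norm x \<le> sup_norm (seq_scale c x)"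
      using False by (simp add: pos_le_divide_eq mult.commute)
    then show ?thesis
      using sup_norm_seq_scale_le[OF x, of c] by simp
  qed
  show ?thesis
    unfolding normed_linear_space_on_def
    by (intro conjI ballI allI iffI vector_space_axioms subspace_bounded_seqs sup_norm_nonneg
        homogeneous triangle definite) (simp_all add: sup_norm_0)
qed

lemma normed_linear_space_on_subspace:
  assumes "normed_linear_space_on smul V N" "W \<subseteq> V" "module.subspace smul W"
  shows "normed_linear_space_on smul W N"
  using assms by (simp add: normed_linear_space_on_def subset_iff)

text \<open>
  The pointwise limit is approached uniformly, so closedness of \<open>L\<close> under uniform limits puts it
  in \<open>L\<close>.
\<close>

lemma norm_complete_on_sup_norm:
  fixes L :: "(nat \<Rightarrow> 'a::{real_normed_field, banach}) set"
  assumes L: "module.subspace seq_scale L" "L \<subseteq> bounded_seqs"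
    and closed: "\<And>\<sigma> x. \<lbrakk>range \<sigma> \<subseteq> L; uniform_limit UNIV \<sigma> x sequentially\<rbrakk> \<Longrightarrow> x \<in> L"
  shows "norm_complete_on L sup_norm"
  unfolding norm_complete_on_def
proof (intro allI impI)
  interpret vector_space "seq_scale :: 'a \<Rightarrow> _" by (rule vector_space_seq_scale)
  fix \<sigma> :: "nat \<Rightarrow> nat \<Rightarrow> 'a"
  assume \<sigma>: "range \<sigma> \<subseteq> L"
    and cauchy: "\<forall>\<epsilon>>0. \<exists>M. \<forall>m\<ge>M. \<forall>n\<ge>M. sup_norm (\<sigma> m - \<sigma> n) < \<epsilon>"
  have diff_bounded: "z - z' \<in> bounded_seqs" if "z \<in> L" "z' \<in> L" for z z'
    using subspace_diff[OF L(1) that] L(2) by blast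
  have "uniformly_Cauchy_on UNIV \<sigma>"
  proof (rule uniformly_Cauchy_onI)
    fix e :: real
    assume "e > 0"
    then obtain M where M: "sup_norm (\<sigma> m - \<sigma> n) < e" if "m \<ge> M" "n \<ge> M" for m n
      using cauchy by blast
    have "dist (\<sigma> m k) (\<sigma> n k) < e" if "m \<ge> M" "n \<ge> M" for m n k
    proof -
      have "norm ((\<sigma> m - \<sigma> n) k) \<le> sup_norm (\<sigma> m - \<sigma> n)"
        using \<sigma> by (intro norm_le_sup_norm diff_bounded) auto
      then show ?thesis
        using M[OF that] by (simp add: dist_norm)
    qed
    then show "\<exists>M. \<forall>k\<in>UNIV. \<forall>m\<ge>M. \<forall>n\<ge>M. dist (\<sigma> m k) (\<sigma> n k) < e"
      by blast
  qed
  then obtain x where x: "uniform_limit UNIV \<sigma> x sequentially"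
    using Cauchy_uniformly_convergent uniformly_convergent_on_def by blast
  have "x \<in> L"
    by (rule closed[OF \<sigma> x])
  moreover have "(\<lambda>n. sup_norm (\<sigma> n - x)) \<longlonglongrightarrow> 0"
  proof (rule tendstoI)
    fix e :: real
    assume "e > 0"
    \<comment> \<open>Halving \<open>e\<close> keeps the inequality strict after passing to the supremum.\<close>
    then have "\<forall>\<^sub>F n in sequentially. \<forall>k\<in>UNIV. dist (\<sigma> n k) (x k) < e / 2"
      by (intro uniform_limitD[OF x]) simp
    then show "\<forall>\<^sub>F n in sequentially. dist (sup_norm (\<sigma> n - x)) 0 < e"
    proof eventually_elim
      case (elim n)
      have "sup_norm (\<sigma> n - x) \<le> e / 2"
        using elim by (intro sup_norm_le) (simp add: dist_norm less_imp_le)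
      moreover have "0 \<le> sup_norm (\<sigma> n - x)"
        using \<sigma> \<open>x \<in> L\<close> by (intro sup_norm_nonneg diff_bounded) auto
      ultimately show ?case
        using \<open>e > 0\<close> by simp
    qed
  qed
  ultimately show "\<exists>x\<in>L. (\<lambda>n. sup_norm (\<sigma> n - x)) \<longlonglongrightarrow> 0"
    by blast
qed

section \<open>The three classical sequence spaces\<close>

lemma convergent_seqs_subset_bounded_seqs: "convergent_seqs \<subseteq> bounded_seqs"
  by (auto simp: convergent_seqs_def bounded_seqs_def convergent_def intro: convergent_imp_bounded)

lemma null_seqs_subset_convergent_seqs: "null_seqs \<subseteq> convergent_seqs"
  by (auto simp: convergent_seqs_def null_seqs_def convergent_def)

lemma subspace_convergent_seqs:
  "module.subspace seq_scale (convergent_seqs :: (nat \<Rightarrow> 'a::real_normed_field) set)"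
proof -
  interpret vector_space "seq_scale :: 'a \<Rightarrow> _" by (rule vector_space_seq_scale)
  show ?thesis
    by (rule subspaceI)
      (auto simp: convergent_seqs_def seq_scale_def plus_fun_def zero_fun_def convergent_const
        intro: convergent_add convergent_mult)
qed

lemma subspace_null_seqs:
  "module.subspace seq_scale (null_seqs :: (nat \<Rightarrow> 'a::real_normed_field) set)"
proof -
  interpret vector_space "seq_scale :: 'a \<Rightarrow> _" by (rule vector_space_seq_scale)
  show ?thesis
    by (rule subspaceI)
      (auto simp: null_seqs_def seq_scale_def plus_fun_def zero_fun_def
        intro: tendsto_add_zero tendsto_mult_right_zero)
qed

lemma bounded_seqs_uniform_limit:
  assumes "range \<sigma> \<subseteq> bounded_seqs" "uniform_limit UNIV \<sigma> x sequentially"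
  shows "x \<in> bounded_seqs"
  using uniform_limit_bounded[OF assms(2) always_eventually] assms(1)
  by (auto simp: bounded_seqs_def)

text \<open>
  Convergence means being Cauchy, and the Cauchy property passes to uniform limits by the
  three-epsilon argument.
\<close>

lemma convergent_seqs_uniform_limit:
  fixes x :: "nat \<Rightarrow> 'a::{real_normed_field, banach}"
  assumes "range \<sigma> \<subseteq> convergent_seqs" "uniform_limit UNIV \<sigma> x sequentially"
  shows "x \<in> convergent_seqs"
proof -
  have "Cauchy x"
  proof (rule metric_CauchyI)
    fix e :: real
    assume "e > 0"
    then have "\<forall>\<^sub>F n in sequentially. \<forall>k\<in>UNIV. dist (\<sigma> n k) (x k) < e / 3"
      by (intro uniform_limitD[OF assms(2)]) simp
    then obtain n where n: "dist (\<sigma> n k) (x k) < e / 3" for k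
      using eventually_happens by force
    have "Cauchy (\<sigma> n)"
      using assms(1) by (auto simp: convergent_seqs_def intro!: convergent_Cauchy)
    then obtain M where M: "dist (\<sigma> n i) (\<sigma> n j) < e / 3" if "i \<ge> M" "j \<ge> M" for i j
      using \<open>e > 0\<close> by (meson metric_CauchyD divide_pos_pos zero_less_numeral)
    have "dist (x i) (x j) < e" if "i \<ge> M" "j \<ge> M" for i j
      using n[of i] n[of j] M[OF that] by metric
    then show "\<exists>M. \<forall>i\<ge>M. \<forall>j\<ge>M. dist (x i) (x j) < e"
      by blast
  qed
  then show ?thesis
    by (simp add: convergent_seqs_def Cauchy_convergent)
qed

lemma null_seqs_uniform_limit:
  assumes "range \<sigma> \<subseteq> null_seqs" "uniform_limit UNIV \<sigma> x sequentially"
  shows "x \<in> null_seqs"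
proof -
  have "x \<longlonglongrightarrow> 0"
  proof (rule tendstoI)
    fix e :: real
    assume "e > 0"
    then have "\<forall>\<^sub>F n in sequentially. \<forall>k\<in>UNIV. dist (\<sigma> n k) (x k) < e / 2"
      by (intro uniform_limitD[OF assms(2)]) simp
    then obtain n where n: "dist (\<sigma> n k) (x k) < e / 2" for k
      using eventually_happens by force
    have "\<sigma> n \<longlonglongrightarrow> 0"
      using assms(1) by (auto simp: null_seqs_def)
    then have "\<forall>\<^sub>F k in sequentially. dist (\<sigma> n k) 0 < e / 2"
      using \<open>e > 0\<close> by (intro tendstoD) simp_all
    then show "\<forall>\<^sub>F k in sequentially. dist (x k) 0 < e"
    proof eventually_elim
      case (elim k)
      then show ?case using n[of k] by metric
    qed
  qed
  then show ?thesis by (simp add: null_seqs_def)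
qed

lemma classical_seqs_banach:
  fixes L :: "(nat \<Rightarrow> 'a::{real_normed_field, banach}) set"
  assumes "L \<in> {bounded_seqs, convergent_seqs, null_seqs}"
  shows "normed_linear_space_on seq_scale L sup_norm" and "norm_complete_on L sup_norm"
proof -
  have L: "module.subspace seq_scale L" "L \<subseteq> bounded_seqs"
    using assms convergent_seqs_subset_bounded_seqs null_seqs_subset_convergent_seqs
    by (auto simp: subspace_bounded_seqs subspace_convergent_seqs subspace_null_seqs)
  show "normed_linear_space_on seq_scale L sup_norm"
    by (rule normed_linear_space_on_subspace[OF normed_linear_space_on_bounded_seqs L(2,1)])
  show "norm_complete_on L sup_norm"
  proof (rule norm_complete_on_sup_norm[OF L])
    fix \<sigma> x
    assume lim: "range \<sigma> \<subseteq> L" "uniform_limit UNIV \<sigma> x sequentially"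
    consider "L = bounded_seqs" | "L = convergent_seqs" | "L = null_seqs"
      using assms by blast
    then show "x \<in> L"
      using lim bounded_seqs_uniform_limit[of \<sigma> x] convergent_seqs_uniform_limit[of \<sigma> x]
        null_seqs_uniform_limit[of \<sigma> x]
      by cases simp_all
  qed
qed

section \<open>The difference transform is a linear bijection\<close>

lemma sum_bdiff: "(\<Sum>i\<le>k. bdiff x i) = x k"
  by (induction k) (simp_all add: bdiff_def)

lemma bdiff_sum: "bdiff (\<lambda>k. \<Sum>i\<le>k. f i) = f"
proof
  show "bdiff (\<lambda>k. \<Sum>i\<le>k. f i) k = f k" for k
    by (cases k) (simp_all add: bdiff_def)
qed

lemma diff_transform_altdef:
  "diff_transform u v x k = u k * (\<Sum>i\<le>k. v i * bdiff x i)"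
  by (simp add: diff_transform_def sum_distrib_left mult.assoc)

lemma linear_diff_transform: "Vector_Spaces.linear seq_scale seq_scale (diff_transform u v)"
proof -
  have "bdiff (x + y) i = bdiff x i + bdiff y i" for x y :: "nat \<Rightarrow> 'a" and i
    by (simp add: bdiff_def)
  moreover have "bdiff (seq_scale c x) i = c * bdiff x i" for c :: 'a and x i
    by (simp add: bdiff_def seq_scale_def algebra_simps)
  ultimately show ?thesis
    unfolding Vector_Spaces.linear_iff
    by (auto simp: vector_space_seq_scale fun_eq_iff seq_scale_def diff_transform_def sum_distrib_left sum.distrib
        algebra_simps)
qed

text \<open>
  The inverse is explicit: \<open>y\<close> comes from the partial sums of \<open>bdiff (y / u) / v\<close>.
\<close>

lemma bij_diff_transform:
  assumes "u \<in> nonzero_seqs" "v \<in> nonzero_seqs"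
  shows "bij (diff_transform u v)"
proof (rule o_bij)
  define S where "S y = (\<lambda>k. \<Sum>i\<le>k. bdiff (\<lambda>j. y j / u j) i / v i)" for y
  have u: "u k \<noteq> 0" and v: "v k \<noteq> 0" for k
    using assms by (auto simp: nonzero_seqs_def)
  show "S \<circ> diff_transform u v = id"
    by (simp add: fun_eq_iff S_def diff_transform_altdef u v bdiff_sum sum_bdiff)
  show "diff_transform u v \<circ> S = id"
    by (simp add: fun_eq_iff S_def diff_transform_altdef u v bdiff_sum sum_bdiff)
qed

section \<open>Completeness of the difference sequence spaces\<close>

theorem theorem1:
  fixes u v :: "nat \<Rightarrow> 'a::{real_normed_field, banach}"
  assumes "u \<in> nonzero_seqs" and "v \<in> nonzero_seqs"
  shows "\<forall>L \<in> {bounded_seqs, convergent_seqs, null_seqs}.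
           normed_linear_space_on seq_scale (diff_space L u v) (diff_norm u v) \<and>
           norm_complete_on (diff_space L u v) (diff_norm u v) \<and>
           (\<forall>x \<in> diff_space L u v. diff_norm u v x = sup_norm (diff_transform u v x))"
proof
  let ?T = "diff_transform u v"
  fix L :: "(nat \<Rightarrow> 'a) set"
  assume L: "L \<in> {bounded_seqs, convergent_seqs, null_seqs}"
  have norm: "diff_norm u v = (\<lambda>x. sup_norm (?T x))"
    by (simp add: fun_eq_iff diff_norm_def sup_norm_def diff_transform_def)
  have space: "diff_space L u v = ?T -` L"
    by (auto simp: diff_space_def)
  have "inj ?T" "surj ?T"
    using bij_diff_transform[OF assms] by (auto simp: bij_def)
  then show "normed_linear_space_on seq_scale (diff_space L u v) (diff_norm u v) \<and>
      norm_complete_on (diff_space L u v) (diff_norm u v) \<and>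
      (\<forall>x \<in> diff_space L u v. diff_norm u v x = sup_norm (?T x))"
    unfolding norm space
    using normed_linear_space_on_vimage[OF linear_diff_transform _ classical_seqs_banach(1)[OF L]]
      norm_complete_on_vimage[OF linear_diff_transform _ classical_seqs_banach(2)[OF L]]
    by simp
qed

end
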